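(* Let $f:X\to X$ be a pointwise periodic homeomorphism of a compact metric space $X$. If $A\in 2^X$ is an almost periodic point of $2^f$, then $C=\bigcup_{n\in\mathbb{N}}f^n(A)$ is a closed subset of $X$ which is strongly $f$-invariant, i.e. $f(C)=C$.
   Context: $f$ is pointwise periodic if for every $x\in X$ there is an integer $n\geq 1$ with $f^n(x)=x$. $2^X$ is the space of nonempty closed subsets of $X$ with the Hausdorff metric, and $2^f:2^X\to 2^X$ is the continuous map $2^f(A)=f(A)$. For a continuous self-map $g$ of a compact metric space $Z$, a point $z\in Z$ is almost periodic if for every neighborhood $U$ of $z$ there exists $N\in\mathbb{N}$ such that $\{g^{n+i}(z): i=0,1,\dots,N\}\cap U\neq\emptyset$ for all integers $n\geq 0$. *)

theory Defs
  imports "HOL-Analysis.Analysis"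
begin

definition pointwise_periodic :: "'a set \<Rightarrow> ('a \<Rightarrow> 'a) \<Rightarrow> bool" where
  "pointwise_periodic X f \<longleftrightarrow> (\<forall>x\<in>X. \<exists>n\<ge>1. (f ^^ n) x = x)"

definition almost_periodic_point :: "'a topology \<Rightarrow> ('a \<Rightarrow> 'a) \<Rightarrow> 'a \<Rightarrow> bool" where
  "almost_periodic_point Z g z \<longleftrightarrow> z \<in> topspace Z \<and>
     (\<forall>U. openin Z U \<and> z \<in> U \<longrightarrow>
        (\<exists>N::nat. \<forall>n::nat. (\<lambda>i. (g ^^ (n + i)) z) ` {0..N} \<inter> U \<noteq> {}))"

definition hyperspace_map :: "('a \<Rightarrow> 'a) \<Rightarrow> 'a set \<Rightarrow> 'a set" where
  "hyperspace_map f A = f ` A"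

context Metric_space
begin

definition hyperspace :: "'a set set" where
  "hyperspace = {A. closedin mtopology A \<and> A \<noteq> {}}"

text \<open>The value 0 off the hyperspace is needed only because the locale
  \<^locale>\<open>Metric_space\<close> asks for nonnegativity on the whole type.
  The suprema are over sets of reals, so the formula is meaningful when the space is bounded,
  in particular when it is compact.\<close>

definition hausdorff_dist :: "'a set \<Rightarrow> 'a set \<Rightarrow> real" where
  "hausdorff_dist A B =
     (if A \<in> hyperspace \<and> B \<in> hyperspace
      then max (SUP a\<in>A. INF b\<in>B. d a b) (SUP b\<in>B. INF a\<in>A. d b a)
      else 0)"

definition hyperspace_topology :: "'a set topology" where
  "hyperspace_topology = Metric_space.mtopology hyperspace hausdorff_dist"

lemma Metric_space_hyperspace:
  assumes "compact_space mtopology"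
  shows "Metric_space hyperspace hausdorff_dist"
proof -
  define e where "e x B = (INF b\<in>B. d x b)" for x B
  define h where "h A B = (SUP a\<in>A. e a B)" for A B
  have hd: "hausdorff_dist A B = (if A \<in> hyperspace \<and> B \<in> hyperspace
      then max (h A B) (h B A) else 0)" for A B
    unfolding hausdorff_dist_def h_def e_def by simp
  have sub: "A \<subseteq> M" and ne: "A \<noteq> {}" if "A \<in> hyperspace" for A
    using that closedin_subset unfolding hyperspace_def by fastforce+
  have "mbounded M"
    using assms compactin_imp_mbounded unfolding compact_space_def by auto
  then obtain K where K: "\<And>x y. x \<in> M \<Longrightarrow> y \<in> M \<Longrightarrow> d x y \<le> K"
    unfolding mbounded_alt by blast
  have bb: "bdd_below (d x ` B)" for x B
    by (rule bdd_belowI2[where m = 0]) simp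
  have ele: "e x B \<le> d x b" if "b \<in> B" for x b B
    unfolding e_def using that bb by (intro cINF_lower)
  have e0: "0 \<le> e x B" if "B \<in> hyperspace" for x B
    unfolding e_def using ne[OF that] by (intro cINF_greatest) auto
  have ba: "bdd_above ((\<lambda>a. e a B) ` A)" if H: "A \<in> hyperspace" "B \<in> hyperspace" for A B
  proof -
    obtain b where b: "b \<in> B" using ne[OF H(2)] by blast
    have "e a B \<le> K" if "a \<in> A" for a
      using ele[OF b, of a] K[of a b] b that sub[OF H(1)] sub[OF H(2)] by fastforce
    then show ?thesis by (rule bdd_aboveI2)
  qed
  have eh: "e a B \<le> h A B" if "a \<in> A" "A \<in> hyperspace" "B \<in> hyperspace" for a A B
    unfolding h_def using that ba by (intro cSUP_upper) auto
  have h0: "0 \<le> h A B" if AB: "A \<in> hyperspace" "B \<in> hyperspace" for A B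
    using ne[OF AB(1)] e0[OF AB(2)] eh[OF _ AB] by (meson all_not_in_conv order_trans)
  have near: "\<exists>b\<in>B. d x b < e x B + r" if "B \<in> hyperspace" "r > 0" for x B r
    using cINF_less_iff[OF ne[OF that(1)] bb, of x "e x B + r"] that(2)
    unfolding e_def by auto
  have htri: "h A C \<le> h A B + h B C"
    if H: "A \<in> hyperspace" "B \<in> hyperspace" "C \<in> hyperspace" for A B C
  proof -
    have "e a C \<le> h A B + h B C" if a: "a \<in> A" for a
    proof (rule field_le_epsilon)
      fix r :: real assume "r > 0"
      then have r2: "r / 2 > 0" by simp
      obtain b where b: "b \<in> B" "d a b < e a B + r / 2" using near[OF H(2) r2] by blast
      obtain c where c: "c \<in> C" "d b c < e b C + r / 2" using near[OF H(3) r2] by blast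
      have "d a c \<le> d a b + d b c" using triangle a b c sub H by blast
      then show "e a C \<le> h A B + h B C + r"
        using ele[OF c(1), of a] b c eh[OF a H(1,2)] eh[OF b(1) H(2,3)] by linarith
    qed
    then show ?thesis
      unfolding h_def[of A C] using ne[OF H(1)] by (intro cSUP_least)
  qed
  have hsub: "A \<subseteq> B" if H: "A \<in> hyperspace" "B \<in> hyperspace" and "h A B \<le> 0" for A B
  proof
    fix a assume a: "a \<in> A"
    then have aM: "a \<in> M" using sub H by blast
    have "e a B \<le> 0" using eh[OF a H] that by linarith
    then have "\<exists>b\<in>B. b \<in> mball a r" if "r > 0" for r
      using near[OF H(2) that, of a] aM sub[OF H(2)] by (force simp: in_mball)
    then have "a \<in> mtopology closure_of B" using aM by (auto simp: metric_closure_of)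
    then show "a \<in> B" using H(2) by (simp add: hyperspace_def closure_of_closedin)
  qed
  have hself: "h A A = 0" if H: "A \<in> hyperspace" for A
  proof -
    have "e a A \<le> 0" if "a \<in> A" for a
      using ele[OF that, of a] sub[OF H] that by (metis mdist_zero subsetD)
    then have "h A A \<le> 0" unfolding h_def using ne[OF H] by (intro cSUP_least)
    then show ?thesis using h0[OF H H] by simp
  qed
  show ?thesis
  proof
    show "0 \<le> hausdorff_dist A B" for A B
      using h0[of A B] by (auto simp: hd)
    show "hausdorff_dist A B = hausdorff_dist B A" for A B
      by (simp add: hd max.commute)
    show "hausdorff_dist A B = 0 \<longleftrightarrow> A = B" if "A \<in> hyperspace" "B \<in> hyperspace" for A B
    proof
      assume "hausdorff_dist A B = 0"
      then have "h A B \<le> 0" "h B A \<le> 0" using that by (auto simp: hd max_def split: if_splits)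
      then show "A = B" using hsub that by blast
    qed (use that hself in \<open>simp add: hd\<close>)
    show "hausdorff_dist A C \<le> hausdorff_dist A B + hausdorff_dist B C"
      if "A \<in> hyperspace" "B \<in> hyperspace" "C \<in> hyperspace" for A B C
      using htri[of A B C] htri[of C B A] that by (simp add: hd max_def)
  qed
qed

end

end

theory Submission
  imports Defs
begin

text \<open>Let \<open>y\<close> be a limit of points \<open>f\<^sup>n(a)\<close> with \<open>a \<in> A\<close>, and suppose that no point of the orbit of
  \<open>y\<close> lies in \<open>A\<close>. The orbit is finite, so it keeps a distance \<open>2\<epsilon> > 0\<close> from \<open>A\<close>. By almost
  periodicity there is \<open>N\<close> such that for every \<open>n\<close> some \<open>i \<le> N\<close> puts \<open>f\<^sup>n\<^sup>+\<^sup>i(A)\<close> within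
  \<open>\<epsilon>\<close> of \<open>A\<close>. If \<open>x = f\<^sup>n(a)\<close> is so close to \<open>y\<close> that the first \<open>N\<close> iterates of \<open>x\<close> and \<open>y\<close> stay
  \<open>\<epsilon>\<close>-close, then \<open>f\<^sup>i(y)\<close> is closer than \<open>2\<epsilon>\<close> to \<open>A\<close>, a contradiction.
  So some \<open>f\<^sup>i(y)\<close> lies in \<open>A\<close>, and \<open>y\<close>, being periodic, is a forward iterate of it.\<close>

lemma hyperspace_map_funpow: "(hyperspace_map f ^^ n) A = (f ^^ n) ` A"
  by (induction n) (auto simp: hyperspace_map_def image_image)

lemma continuous_map_funpow:
  assumes "continuous_map T T f"
  shows "continuous_map T T (f ^^ n)"
  using assms by (induction n) (auto intro: continuous_map_compose simp: id_def[symmetric])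

text \<open>The total \<open>p * i\<close> is a multiple of the period and, since
  \<open>p \<ge> 1\<close>, at least \<open>i\<close>, so the subtraction on naturals is
  exact.\<close>

lemma funpow_backward:
  assumes "(f ^^ p) y = y" "p \<ge> 1"
  shows "(f ^^ (p * i - i)) ((f ^^ i) y) = y"
proof -
  have "i \<le> p * i" using assms(2) by simp
  then have "(f ^^ (p * i - i)) ((f ^^ i) y) = (f ^^ (p * i)) y"
    using funpow_add[of "p * i - i" i f] by simp
  also have "\<dots> = y" using funpow_mod_eq[OF assms(1), of "p * i"] by simp
  finally show ?thesis .
qed

context Metric_space
begin

text \<open>Boundedness makes the supremum over \<open>B\<close> a genuine upper bound. An infimum
  strictly below \<open>r\<close> has a witness below \<open>r\<close>, so it need not be
  attained.\<close>

lemma hausdorff_dist_less_imp_near: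
  assumes "mbounded M" and A: "A \<in> hyperspace" and B: "B \<in> hyperspace"
    and less: "hausdorff_dist A B < r" and b: "b \<in> B"
  shows "\<exists>a\<in>A. d b a < r"
proof -
  obtain K where K: "\<And>x y. x \<in> M \<Longrightarrow> y \<in> M \<Longrightarrow> d x y \<le> K"
    using assms(1) unfolding mbounded_alt by blast
  have sub: "A \<subseteq> M" "B \<subseteq> M" and ne: "A \<noteq> {}"
    using A B closedin_subset[of mtopology] by (auto simp: hyperspace_def)
  obtain a where a: "a \<in> A" using ne by blast
  have bb: "bdd_below (d x ` A)" for x
    by (rule bdd_belowI2[where m = 0]) simp
  have "bdd_above ((\<lambda>x. INF a\<in>A. d x a) ` B)"
  proof (rule bdd_aboveI2)
    fix x assume "x \<in> B"
    then show "(INF a\<in>A. d x a) \<le> K"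
      using cINF_lower[OF bb a, of x] K[of x a] a sub by fastforce
  qed
  then have "(INF a\<in>A. d b a) \<le> (SUP b\<in>B. INF a\<in>A. d b a)"
    using b by (rule cSUP_upper[rotated])
  also have "\<dots> < r"
    using less A B by (simp add: hausdorff_dist_def)
  finally show ?thesis
    using cINF_less_iff[OF ne bb] by blast
qed

lemma finite_disjoint_closedin_gap:
  assumes "closedin mtopology A" "finite F" "F \<subseteq> M" "F \<inter> A = {}"
  shows "\<exists>e>0. \<forall>x\<in>F. \<forall>a\<in>A. e \<le> d x a"
proof -
  \<comment> \<open>Phrasing the gap as a property of all small \<open>e > 0\<close> lets finitely
    many points share one \<open>e\<close> without an explicit minimum of radii.\<close>
  have "eventually (\<lambda>e. \<forall>a\<in>A. e \<le> d x a) (at_right 0)" if "x \<in> F" for x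
  proof -
    have "x \<in> M - A" using assms(3,4) that by blast
    then obtain r where r: "r > 0" "disjnt A (mball x r)"
      using assms(1) unfolding closedin_metric by blast
    have "e \<le> d x a" if "e < r" "a \<in> A" for e a
    proof -
      have "a \<in> M" "x \<in> M" using closedin_subset[OF assms(1)] assms(3) \<open>x \<in> F\<close> that by auto
      moreover have "a \<notin> mball x r" using r(2) that(2) by (auto simp: disjnt_iff)
      ultimately show ?thesis using that(1) by simp
    qed
    then show ?thesis
      unfolding eventually_at_right_field using r(1) by blast
  qed
  then have "eventually (\<lambda>e. \<forall>x\<in>F. \<forall>a\<in>A. e \<le> d x a) (at_right (0::real))"
    using assms(2) by (intro eventually_ball_finite) auto
  with eventually_at_right_less[of "0::real"]
  have "eventually (\<lambda>e. 0 < e \<and> (\<forall>x\<in>F. \<forall>a\<in>A. e \<le> d x a)) (at_right (0::real))"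
    by eventually_elim simp
  then show ?thesis
    using eventually_happens'[of "at_right (0::real)"] by auto
qed

lemma closure_of_iterates_meets:
  assumes compact: "compact_space mtopology"
    and cont: "continuous_map mtopology mtopology f"
    and A: "A \<in> hyperspace"
    and ap: "almost_periodic_point hyperspace_topology (hyperspace_map f) A"
    and y: "y \<in> mtopology closure_of (\<Union>n. (f ^^ n) ` A)"
    and per: "(f ^^ p) y = y" "p \<ge> 1"
  shows "\<exists>i. (f ^^ i) y \<in> A"
proof (rule ccontr)
  assume no: "\<nexists>i. (f ^^ i) y \<in> A"
  interpret H: Metric_space hyperspace hausdorff_dist
    using Metric_space_hyperspace[OF compact] .
  have bounded: "mbounded M"
    using compact compactin_imp_mbounded unfolding compact_space_def by auto
  have yM: "y \<in> M" using y closure_of_subset_topspace[of mtopology] by auto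
  have contn: "continuous_map mtopology mtopology (f ^^ i)" for i
    using cont by (rule continuous_map_funpow)
  have inM: "(f ^^ i) x \<in> M" if "x \<in> M" for i x
    using contn[of i] that by (auto simp: continuous_map_def)
  have "closedin mtopology A" using A by (simp add: hyperspace_def)
  moreover have "(\<lambda>i. (f ^^ i) y) ` {..<p} \<inter> A = {}" using no by auto
  moreover have "(\<lambda>i. (f ^^ i) y) ` {..<p} \<subseteq> M" using inM yM by blast
  ultimately obtain e where e: "e > 0" "\<And>i a. i < p \<Longrightarrow> a \<in> A \<Longrightarrow> e \<le> d ((f ^^ i) y) a"
    using finite_disjoint_closedin_gap[of A "(\<lambda>i. (f ^^ i) y) ` {..<p}"] by auto
  \<comment> \<open>Reducing \<open>i\<close> modulo \<open>p\<close> extends the gap from one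
    period to all iterates of \<open>y\<close>.\<close>
  have gap: "e \<le> d ((f ^^ i) y) a" if "a \<in> A" for i a
    using e(2)[of "i mod p" a] funpow_mod_eq[OF per(1), of i] per(2) that by simp
  \<comment> \<open>Here \<open>e\<close> is the 2\<epsilon> of the overview: one half is spent on
    the Hausdorff distance, the other on the distance between iterates.\<close>
  obtain N where N: "\<And>n. (\<lambda>i. (hyperspace_map f ^^ (n + i)) A) ` {0..N} \<inter> H.mball A (e/2) \<noteq> {}"
  proof -
    have "openin H.mtopology (H.mball A (e/2))" "A \<in> H.mball A (e/2)"
      using A e(1) by auto
    then show ?thesis
      using ap that unfolding almost_periodic_point_def hyperspace_topology_def by blast
  qed
  \<comment> \<open>\<open>N\<close> does not depend on \<open>n\<close>, so \<open>V\<close> can be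
    fixed before \<open>n\<close> is known; being a finite intersection of open preimages, it is
    open.\<close>
  define V where "V = (\<Inter>i\<in>{0..N}. {x \<in> topspace mtopology. (f ^^ i) x \<in> mball ((f ^^ i) y) (e/2)})"
  have "openin mtopology V"
    unfolding V_def using contn
    by (intro openin_INT2 openin_continuous_map_preimage[where Y = mtopology]) auto
  moreover have "y \<in> V"
    unfolding V_def using yM inM e(1) by auto
  ultimately obtain n a where a: "a \<in> A" "(f ^^ n) a \<in> V"
    using y unfolding in_closure_of by blast
  from N[of n] obtain i where i: "i \<le> N" "(f ^^ (n + i)) ` A \<in> H.mball A (e/2)"
    unfolding hyperspace_map_funpow disjoint_iff image_iff Bex_def atLeastAtMost_iff by blast
  have shift: "(f ^^ i) ((f ^^ n) a) = (f ^^ (n + i)) a"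
    using funpow_add[of i n f] by (simp add: add.commute)
  \<comment> \<open>Membership in the ball also says that the image of \<open>A\<close> belongs to
    \<open>hyperspace\<close>.\<close>
  obtain b where b: "b \<in> A" "d ((f ^^ (n + i)) a) b < e/2"
    using hausdorff_dist_less_imp_near[OF bounded A, of "(f ^^ (n + i)) ` A" "e/2"] i(2) a(1)
    by auto
  have "(f ^^ i) ((f ^^ n) a) \<in> mball ((f ^^ i) y) (e/2)"
    using INT_D[OF a(2)[unfolded V_def], of i] i(1) by simp
  then have "d ((f ^^ i) y) ((f ^^ (n + i)) a) < e/2" "(f ^^ (n + i)) a \<in> M"
    unfolding shift by auto
  moreover have "b \<in> M"
    using b(1) A closedin_subset[of mtopology A] by (auto simp: hyperspace_def)
  ultimately have "d ((f ^^ i) y) b < e"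
    using triangle[of "(f ^^ i) y" "(f ^^ (n + i)) a" b] inM[OF yM, of i] b(2) by linarith
  then show False using gap[OF b(1), of i] by simp
qed

end

theorem proposition4p1:
  fixes X :: "'a set" and d :: "'a \<Rightarrow> 'a \<Rightarrow> real" and f :: "'a \<Rightarrow> 'a" and A :: "'a set"
  assumes "Metric_space X d"
    and "compact_space (Metric_space.mtopology X d)"
    and "homeomorphic_map (Metric_space.mtopology X d) (Metric_space.mtopology X d) f"
    and "pointwise_periodic X f"
    and "A \<in> Metric_space.hyperspace X d"
    and "almost_periodic_point (Metric_space.hyperspace_topology X d) (hyperspace_map f) A"
  shows "closedin (Metric_space.mtopology X d) (\<Union>n::nat. (f ^^ n) ` A)
    \<and> f ` (\<Union>n::nat. (f ^^ n) ` A) = (\<Union>n::nat. (f ^^ n) ` A)"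
proof -
  interpret Metric_space X d by fact
  let ?C = "\<Union>n::nat. (f ^^ n) ` A"
  have cont: "continuous_map mtopology mtopology f"
    using assms(3) by (rule homeomorphic_imp_continuous_map)
  have "A \<subseteq> X"
    using assms(5) closedin_subset[of mtopology A] by (simp add: hyperspace_def)
  then have CX: "?C \<subseteq> X"
    using continuous_map_image_subset_topspace[OF continuous_map_funpow[OF cont]] by fastforce
  have step: "f ` ?C \<subseteq> ?C"
  proof clarify
    fix n a assume "a \<in> A"
    then have "f ((f ^^ n) a) \<in> (f ^^ Suc n) ` A" by simp
    then show "f ((f ^^ n) a) \<in> ?C" by blast
  qed
  have steps: "(f ^^ k) x \<in> ?C" if "x \<in> ?C" for k x
  proof (induction k)
    case (Suc k)
    then have "f ((f ^^ k) x) \<in> ?C" using step by blast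
    then show ?case by simp
  qed (use that in simp)
  have "mtopology closure_of ?C \<subseteq> ?C"
  proof
    fix y assume y: "y \<in> mtopology closure_of ?C"
    then have "y \<in> X" using closure_of_subset_topspace[of mtopology] by auto
    then obtain p where p: "(f ^^ p) y = y" "p \<ge> 1"
      using assms(4) unfolding pointwise_periodic_def by blast
    obtain i where "(f ^^ i) y \<in> A"
      using closure_of_iterates_meets[OF assms(2) cont assms(5,6) y p] by blast
    then show "y \<in> ?C"
      \<comment> \<open>Periodicity turns the forward iterate lying in \<open>A\<close> into a
        starting point from which \<open>y\<close> is reached.\<close>
      using funpow_backward[OF p, of i] by (metis UNIV_I UN_I imageI)
  qed
  then have "closedin mtopology ?C"
    using CX closure_of_subset_eq[of ?C mtopology] by simp
  moreover have "?C \<subseteq> f ` ?C"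
  proof
    fix x assume x: "x \<in> ?C"
    then obtain p where p: "(f ^^ p) x = x" "p \<ge> 1"
      using assms(4) CX unfolding pointwise_periodic_def by blast
    \<comment> \<open>The preimage of \<open>x\<close> is its last predecessor along the cycle,
      which forward invariance keeps in \<open>?C\<close>.\<close>
    then obtain k where "p = Suc k" by (cases p) auto
    then have "x = f ((f ^^ k) x)" using p(1) by simp
    then show "x \<in> f ` ?C" using steps[OF x, of k] by blast
  qed
  ultimately show ?thesis using step by blast
qed

end
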